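(* Let $0<s<1$, and let $G\subset\mathbb{R}^n$ be a bounded domain that is convex in the $x_n$-direction. Let $u,v\in L_{2s}\cap C^{1,1}_{loc}(G)\cap C(\overline{G})$ and let $(u,v)$ be a pair of solutions of $$\begin{cases}(-\Delta)^s u(x)=f(u,v), & x\in G,\\ (-\Delta)^s v(x)=g(u,v), & x\in G,\\ u(x)=\varphi(x),\quad v(x)=\psi(x), & x\in G^c,\end{cases}$$ where $G^c=\mathbb{R}^n\setminus G$. Suppose that $u,v$ satisfy the following exterior condition on $G$: for any three points $x^1=(x',x^1_n)$, $x^2=(x',x^2_n)$, $x^3=(x',x^3_n)$ with $x'\in\mathbb{R}^{n-1}$, $x^1_n<x^2_n<x^3_n$ and $x^1,x^3\in G^c$, one has $$\varphi(x^1)<u(x^2)<\varphi(x^3)\ \text{ and }\ \psi(x^1)<v(x^2)<\psi(x^3)\quad\text{for } x^2\in G,$$ $$\varphi(x^1)\le\varphi(x^2)\le\varphi(x^3)\ \text{ and }\ \psi(x^1)\le\psi(x^2)\le\psi(x^3)\quad\text{for } x^2\in G^c.$$ If $\frac{\partial f}{\partial v}>0$ and $\frac{\partial g}{\partial u}>0$ for $x\in G$, and $\frac{\partial f}{\partial u},\frac{\partial f}{\partial v},\frac{\partial g}{\partial u},\frac{\partial g}{\partial v}$ are bounded from above in $G$ (the partial derivatives being taken at $(u(x),v(x))$, $x\in G$), then $u$ and $v$ are monotone increasing with respect to the $x_n$-variable in $G$. More precisely, for any $\tau>0$, $$u(x',\tau+x_n)>u(x',x_n)\quad\text{and}\quad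 v(x',\tau+x_n)>v(x',x_n)\qquad \forall\,(x',\tau+x_n),\,(x',x_n)\in G.$$
   Context: Points of $\mathbb{R}^n$ are written $x=(x',x_n)$ with $x'=(x_1,\dots,x_{n-1})\in\mathbb{R}^{n-1}$. Here $f=f(u,v)$ and $g=g(u,v)$ are real functions of two real variables, $f(u,v)$ in the system means $f(u(x),v(x))$ (similarly for $g$), and $\varphi,\psi$ are given real functions on $G^c$. $L_{2s}=\{u:\mathbb{R}^n\to\mathbb{R}\mid \int_{\mathbb{R}^n}\frac{|u(x)|}{1+|x|^{n+2s}}\,dx<\infty\}$. The fractional Laplacian is $$(-\Delta)^s u(x)=C_{n,s}\,\mathrm{PV}\int_{\mathbb{R}^n}\frac{u(x)-u(z)}{|x-z|^{n+2s}}\,dz,$$ where PV is the Cauchy principal value and $C_{n,s}>0$ is a normalizing constant. $C^{1,1}_{loc}(G)$ is the set of functions that are $C^1$ in $G$ with locally Lipschitz gradient. The functions $u,v$ are defined on all of $\mathbb{R}^n$; membership in $C^{1,1}_{loc}(G)$ or $C(\overline G)$ refers to their restrictions. $G$ is convex in the $x_n$-direction if $(x',a),(x',b)\in G$ implies that the segment joining them lies in $G$.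
   Formalization: The existence, sign and upper-bound conditions on the partial derivatives of f and g are imposed at all (u(x),v(y)) with x,y in G, not only at (u(x),v(x)); with the latter alone the claim fails (a counterexample exists for n=1). *)

theory Defs
  imports "HOL-Analysis.Analysis"
begin

text \<open>
  Points of $n$-space are vectors \<open>x :: real ^ 'n\<close> with \<open>n = CARD('n)\<close>. The distinguished
  coordinate $x_n$ is \<open>x $ k\<close> for an index \<open>k :: 'n\<close>, and $x'$ consists of the remaining
  coordinates.
\<close>

definition same_prime :: "'n::finite \<Rightarrow> real ^ 'n \<Rightarrow> real ^ 'n \<Rightarrow> bool" where
  "same_prime k x y \<longleftrightarrow> (\<forall>i. i \<noteq> k \<longrightarrow> x $ i = y $ i)"

definition convex_in_direction :: "'n::finite \<Rightarrow> (real ^ 'n) set \<Rightarrow> bool" where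
  "convex_in_direction k G \<longleftrightarrow>
     (\<forall>x\<in>G. \<forall>y\<in>G. same_prime k x y \<longrightarrow> closed_segment x y \<subseteq> G)"

definition is_domain :: "(real ^ 'n::finite) set \<Rightarrow> bool" where
  "is_domain G \<longleftrightarrow> open G \<and> connected G \<and> G \<noteq> {}"

definition L2s :: "real \<Rightarrow> (real ^ 'n::finite \<Rightarrow> real) set" where
  "L2s s = {u. u \<in> borel_measurable lebesgue \<and>
     (\<integral>\<^sup>+x. ennreal (\<bar>u x\<bar> / (1 + norm x powr (real CARD('n) + 2 * s))) \<partial>lebesgue) < \<infinity>}"

text \<open>
  \<open>G\<close> is meant to be open, so that \<open>D\<close> depends only on the restriction of \<open>u\<close> to \<open>G\<close>;
  continuity of the gradient follows from its local Lipschitz continuity.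
\<close>
definition C11_loc :: "(real ^ 'n::finite) set \<Rightarrow> (real ^ 'n \<Rightarrow> real) set" where
  "C11_loc G = {u. \<exists>D. (\<forall>x\<in>G. GDERIV u x :> D x) \<and>
     (\<forall>x\<in>G. \<exists>r>0. \<exists>L. L-lipschitz_on (ball x r \<inter> G) D)}"

text \<open>
  \<open>has_frac_laplacian C s u x L\<close>: the principal value exists and $(-\Delta)^s u(x) = L$, with
  normalizing constant \<open>C\<close>. For \<open>u \<in> L2s s\<close> with \<open>0 < s\<close> the integrability requirement
  (which excludes the default value of the integral) always holds.
\<close>
definition has_frac_laplacian ::
  "real \<Rightarrow> real \<Rightarrow> (real ^ 'n::finite \<Rightarrow> real) \<Rightarrow> real ^ 'n \<Rightarrow> real \<Rightarrow> bool" where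
  "has_frac_laplacian C s u x L \<longleftrightarrow>
     (\<forall>\<epsilon>>0. set_integrable lebesgue (- ball x \<epsilon>)
        (\<lambda>z. (u x - u z) / norm (x - z) powr (real CARD('n) + 2 * s))) \<and>
     ((\<lambda>\<epsilon>. C * (LINT z:(- ball x \<epsilon>)|lebesgue.
        (u x - u z) / norm (x - z) powr (real CARD('n) + 2 * s))) \<longlongrightarrow> L) (at_right 0)"

text \<open>
  Only the values of \<open>\<phi>\<close> on the complement of \<open>G\<close> matter.
\<close>
definition exterior_condition ::
  "'n::finite \<Rightarrow> (real ^ 'n) set \<Rightarrow> (real ^ 'n \<Rightarrow> real) \<Rightarrow> (real ^ 'n \<Rightarrow> real) \<Rightarrow> bool" where
  "exterior_condition k G \<phi> u \<longleftrightarrow>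
     (\<forall>x1 x2 x3. same_prime k x1 x2 \<and> same_prime k x2 x3 \<and>
        x1 $ k < x2 $ k \<and> x2 $ k < x3 $ k \<and> x1 \<in> - G \<and> x3 \<in> - G \<longrightarrow>
        (x2 \<in> G \<longrightarrow> \<phi> x1 < u x2 \<and> u x2 < \<phi> x3) \<and>
        (x2 \<in> - G \<longrightarrow> \<phi> x1 \<le> \<phi> x2 \<and> \<phi> x2 \<le> \<phi> x3))"

text \<open>
  \<open>has_partials_on R h h1 h2\<close>: the partial derivatives of \<open>h\<close> exist on \<open>R\<close> and are \<open>h1\<close>, \<open>h2\<close>.
  In the theorem \<open>R = u ` G \<times> v ` G\<close>, i.e. the two arguments of the nonlinearities range
  independently over the values of \<open>u\<close> and of \<open>v\<close> in \<open>G\<close>. Conditions on the partial derivatives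
  at the points \<open>(u x, v x)\<close>, \<open>x \<in> G\<close>, alone would not suffice: comparing \<open>h (u y) (v y)\<close> with
  \<open>h (u x) (v x)\<close> by the mean value theorem involves intermediate values of the arguments, and
  with that weaker hypothesis the monotonicity can fail.
\<close>
definition has_partials_on ::
  "(real \<times> real) set \<Rightarrow> (real \<Rightarrow> real \<Rightarrow> real) \<Rightarrow>
   (real \<Rightarrow> real \<Rightarrow> real) \<Rightarrow> (real \<Rightarrow> real \<Rightarrow> real) \<Rightarrow> bool" where
  "has_partials_on R h h1 h2 \<longleftrightarrow>
     (\<forall>(a, b)\<in>R. ((\<lambda>t. h t b) has_real_derivative h1 a b) (at a) \<and>
                  ((\<lambda>t. h a t) has_real_derivative h2 a b) (at b))"

end

theory Submission
  imports Defs
begin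

text \<open>
  The proof is a sliding argument. For \<open>\<tau> > 0\<close> compare \<open>u\<close> and \<open>v\<close> with their translates by \<open>\<tau>\<close>
  in direction \<open>k\<close>, and call \<open>\<tau>\<close> ordered if neither function decreases under the translation. Outside
  the set of points that stay in \<open>G\<close> this always holds, by the exterior condition. The set of
  ordered \<open>\<tau>\<close> contains all large \<open>\<tau>\<close>, and it is closed in the half-line \<open>{0<..}\<close> because \<open>u\<close> and \<open>v\<close>
  are continuous in \<open>G\<close> and \<open>G\<close> is open. If it is also open, it is the whole half-line.

  Everything else rests on one estimate (\<open>increment_at_minimum\<close>). Let the increment \<open>w\<close> of \<open>u\<close> attain
  its global minimum \<open>- m \<le> 0\<close> at a point that the translation keeps in \<open>G\<close>, and let the increment of
  \<open>v\<close> be at least \<open>- m\<close> there.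
  Since \<open>f\<close> increases in its second argument and its partial derivatives are bounded by \<open>M\<close>, the
  fractional Laplacian of \<open>w\<close> at that point is at least \<open>- 2 * M * m\<close>
  (\<open>cooperative_increment_bound\<close>). On the other hand, being \<open>C\<close> times an integral of
  nonpositive differences, it is at most \<open>- C * c * |S| / R powr (n + 2 * s)\<close> for every measurable set \<open>S\<close> within
  distance \<open>R\<close> on which \<open>w \<ge> - m + c\<close> (\<open>has_frac_laplacian_at_minimum\<close>). Two consequences follow.

  With \<open>m = 0\<close>: if \<open>\<tau>\<close> is ordered, then both functions strictly increase under the translation
  wherever it stays in \<open>G\<close> (\<open>ordered_imp_strict\<close>), because the exterior condition is strict on a ball
  that the translation moves out of \<open>G\<close>.

  With \<open>c = m\<close>: the increments cannot have a negative minimum if they are nonnegative outside a set of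
  small measure (\<open>narrow_region_principle\<close>), because a small ball about the minimum point lies half
  outside that set and contributes a multiple of \<open>R powr (- 2 * s)\<close>.

  Together they show that the set of ordered \<open>\<tau>\<close> is open (\<open>ordered_persists_nearby\<close>): on a large
  compact part of \<open>G\<close> the strict inequality survives a small change of \<open>\<tau>\<close>, and the rest of \<open>G\<close> is
  small in measure. Strict monotonicity for every \<open>\<tau>\<close> is then the first consequence again.
\<close>

section \<open>The fractional Laplacian\<close>

lemma lebesgue_translation:
  fixes h :: "'a::euclidean_space"
  shows "(\<lambda>x. x + h) \<in> lebesgue \<rightarrow>\<^sub>M lebesgue"
    and "distr lebesgue lebesgue (\<lambda>x. x + h) = lebesgue"
proof -
  have eq: "(\<lambda>x. h + (\<Sum>j\<in>Basis. (1 * (x \<bullet> j)) *\<^sub>R j)) = (\<lambda>x. x + h)"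
    by (simp add: euclidean_representation add.commute)
  show meas: "(\<lambda>x. x + h) \<in> lebesgue \<rightarrow>\<^sub>M lebesgue"
    using lebesgue_affine_measurable[of "\<lambda>_. 1" h] unfolding eq by simp
  show "distr lebesgue lebesgue (\<lambda>x. x + h) = lebesgue"
    using lebesgue_affine_euclidean[of "\<lambda>_. 1" h] unfolding eq
    by (simp add: density_1)
qed

lemma measurable_shift:
  fixes h :: "'a::euclidean_space"
  assumes "u \<in> borel_measurable lebesgue"
  shows "(\<lambda>x. u (x + h)) \<in> borel_measurable lebesgue"
  using measurable_compose[OF lebesgue_translation(1) assms] .

lemma has_frac_laplacian_shift:
  fixes u :: "real ^ 'n::finite \<Rightarrow> real"
  assumes u: "u \<in> borel_measurable lebesgue" and L: "has_frac_laplacian C s u (x + h) L"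
  shows "has_frac_laplacian C s (\<lambda>y. u (y + h)) x L"
proof -
  define p where "p = real CARD('n) + 2 * s"
  define F where "F e z = indicator (- ball (x + h) e) z *\<^sub>R
      ((u (x + h) - u z) / norm (x + h - z) powr p)" for e and z :: "real ^ 'n"
  define F' where "F' e z = indicator (- ball x e) z *\<^sub>R
      ((u (x + h) - u (z + h)) / norm (x - z) powr p)" for e and z :: "real ^ 'n"
  have eq: "F' e = (\<lambda>z. F e (z + h))" for e
    by (auto simp: F_def F'_def indicator_def dist_norm fun_eq_iff)
  have int: "integrable lebesgue (F e)" if "e > 0" for e
    using L that unfolding has_frac_laplacian_def set_integrable_def F_def p_def by auto
  have 1: "integrable lebesgue (F' e)" if "e > 0" for e
    using int[OF that] integrable_distr[OF lebesgue_translation(1)[of h], of "F e"]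
    unfolding eq lebesgue_translation(2) by auto
  have 2: "integral\<^sup>L lebesgue (F' e) = integral\<^sup>L lebesgue (F e)" if "e > 0" for e
    using integral_distr[OF lebesgue_translation(1)[of h], of "F e"] int[OF that]
    unfolding eq lebesgue_translation(2) by auto
  have "((\<lambda>e. C * integral\<^sup>L lebesgue (F e)) \<longlongrightarrow> L) (at_right 0)"
    using L unfolding has_frac_laplacian_def set_lebesgue_integral_def F_def p_def by auto
  then have "((\<lambda>e. C * integral\<^sup>L lebesgue (F' e)) \<longlongrightarrow> L) (at_right 0)"
    by (rule Lim_transform_eventually)
       (auto simp: 2 eventually_at_right_less intro!: eventually_at_rightI[of 0 1])
  with 1 show ?thesis
    unfolding has_frac_laplacian_def set_integrable_def set_lebesgue_integral_def F'_def p_def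
    by auto
qed

lemma has_frac_laplacian_diff:
  assumes u: "has_frac_laplacian C s u x K" and v: "has_frac_laplacian C s v x L"
  shows "has_frac_laplacian C s (\<lambda>y. u y - v y) x (K - L)"
proof -
  define p where "p = real CARD('a) + 2 * s"
  define I where "I w z = (w x - w z) / norm (x - z) powr p" for w :: "real ^ 'a \<Rightarrow> real" and z
  have split: "I (\<lambda>y. u y - v y) = (\<lambda>z. I u z - I v z)"
    by (auto simp: I_def diff_divide_distrib[symmetric])
  have iu: "set_integrable lebesgue (- ball x e) (I u)"
    and iv: "set_integrable lebesgue (- ball x e) (I v)" if "e > 0" for e
    using u v that unfolding has_frac_laplacian_def I_def p_def by auto
  have "((\<lambda>e. C * (LINT z:(- ball x e)|lebesgue. I u z) - C * (LINT z:(- ball x e)|lebesgue. I v z))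
      \<longlongrightarrow> K - L) (at_right 0)"
    using u v unfolding has_frac_laplacian_def I_def p_def by (intro tendsto_diff) auto
  then have "((\<lambda>e. C * (LINT z:(- ball x e)|lebesgue. I (\<lambda>y. u y - v y) z)) \<longlongrightarrow> K - L) (at_right 0)"
    by (rule Lim_transform_eventually)
       (auto simp: split set_integral_diff(2)[OF iu iv] right_diff_distrib
         intro!: eventually_at_rightI[of 0 1])
  moreover have "set_integrable lebesgue (- ball x e) (I (\<lambda>y. u y - v y))" if "e > 0" for e
    using iu[OF that] iv[OF that] unfolding split by (rule set_integral_diff)
  ultimately show ?thesis
    unfolding has_frac_laplacian_def I_def p_def by auto
qed

text \<open>
  At a global minimum of \<open>w\<close> the integrand \<open>(w x - w z) / norm (x - z) powr p\<close>, with
  \<open>p = n + 2 * s\<close>, is nonpositive, and on \<open>S\<close> it is at most \<open>- c / R powr p\<close>. So every set of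
  positive measure on which \<open>w\<close> lies above its minimum makes the fractional Laplacian negative by
  a definite amount. This is the nonlocal effect behind all comparison arguments below.
\<close>
lemma has_frac_laplacian_at_minimum:
  fixes w :: "real ^ 'n::finite \<Rightarrow> real"
  assumes "0 < s" "0 < C" and L: "has_frac_laplacian C s w x L"
    and min: "\<And>y. w x \<le> w y"
    and S: "S \<in> sets lebesgue" "S \<subseteq> cball x R" and c: "0 \<le> c" "\<And>y. y \<in> S \<Longrightarrow> w x + c \<le> w y"
  shows "C * c * measure lebesgue S / R powr (real CARD('n) + 2 * s) \<le> - L"
proof -
  define p where "p = real CARD('n) + 2 * s"
  have "p > 0" using \<open>0 < s\<close> by (simp add: p_def add_pos_pos)
  define I where "I z = (w x - w z) / norm (x - z) powr p" for z
  have fmS: "S \<in> lmeasurable"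
    using S by (meson bounded_cball bounded_set_imp_lmeasurable bounded_subset)
  have int: "set_integrable lebesgue (- ball x e) I" if "e > 0" for e
    using L that unfolding has_frac_laplacian_def I_def p_def by auto
  have lim: "((\<lambda>e. C * (LINT z:(- ball x e)|lebesgue. I z)) \<longlongrightarrow> L) (at_right 0)"
    using L unfolding has_frac_laplacian_def I_def p_def by auto
  \<comment> \<open>The part of \<open>S\<close> inside the excised ball is lost, but its measure vanishes in the limit.\<close>
  have bound: "C * (LINT z:(- ball x e)|lebesgue. I z)
      \<le> - (C * (c / R powr p) * (measure lebesgue S - measure lebesgue (ball x e)))"
    if "e > 0" for e
  proof -
    have fm: "S - ball x e \<in> lmeasurable"
      using fmS by (simp add: fmeasurable.Diff)
    have pw: "I z \<le> - (c / R powr p) * indicator S z" if "z \<in> - ball x e" for z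
    proof (cases "z \<in> S")
      case True
      have n: "0 < norm (x - z)" "norm (x - z) \<le> R"
        using that \<open>e > 0\<close> True S by (auto simp: dist_norm)
      have "c / R powr p \<le> c / norm (x - z) powr p"
        using n c \<open>p > 0\<close> by (intro divide_left_mono powr_mono2 mult_pos_pos) auto
      also have "\<dots> \<le> (w z - w x) / norm (x - z) powr p"
        using c True by (intro divide_right_mono) (auto simp: algebra_simps)
      also have "\<dots> = - I z"
        by (simp add: I_def minus_divide_left)
      finally show ?thesis using True by simp
    next
      case False
      then show ?thesis using min[of z] by (simp add: I_def divide_nonpos_nonneg)
    qed
    have eq: "(\<lambda>z. indicator (- ball x e) z *\<^sub>R (- (c / R powr p) * indicator S z))
        = (\<lambda>z. - (c / R powr p) * indicator (S - ball x e) z)"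
      by (auto simp: indicator_def fun_eq_iff)
    have si: "set_integrable lebesgue (- ball x e) (\<lambda>z. - (c / R powr p) * indicator S z)"
      unfolding set_integrable_def eq
      using fm by (intro integrable_mult_right integrable_real_indicator) (auto simp: fmeasurable_def)
    have "(LINT z:(- ball x e)|lebesgue. I z)
        \<le> (LINT z:(- ball x e)|lebesgue. - (c / R powr p) * indicator S z)"
      by (rule set_integral_mono[OF int[OF that] si pw])
    also have "\<dots> = - (c / R powr p) * measure lebesgue (S - ball x e)"
      unfolding set_lebesgue_integral_def eq by simp
    also have "\<dots> \<le> - (c / R powr p) * (measure lebesgue S - measure lebesgue (ball x e))"
    proof -
      have "measure lebesgue S \<le> measure lebesgue ((S - ball x e) \<union> ball x e)"
        using fm fmS by (intro measure_mono_fmeasurable) auto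
      also have "\<dots> \<le> measure lebesgue (S - ball x e) + measure lebesgue (ball x e)"
        using fm by (intro measure_Un_le) auto
      finally have "measure lebesgue S - measure lebesgue (ball x e) \<le> measure lebesgue (S - ball x e)"
        by simp
      then show ?thesis
        using c by (intro mult_left_mono_neg) auto
    qed
    finally show ?thesis
      using \<open>0 < C\<close> by (metis mult.assoc mult_le_cancel_left_pos mult_minus_left mult_minus_right)
  qed
  have ball: "((\<lambda>e. measure lebesgue (ball x e)) \<longlongrightarrow> 0) (at_right 0)"
  proof (rule Lim_transform_eventually)
    have "((\<lambda>e. unit_ball_vol CARD('n) * e ^ CARD('n)) \<longlongrightarrow> unit_ball_vol CARD('n) * 0 ^ CARD('n)) (at_right 0)"
      by (intro tendsto_intros)
    then show "((\<lambda>e. unit_ball_vol CARD('n) * e ^ CARD('n)) \<longlongrightarrow> 0) (at_right 0)"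
      by (simp add: zero_power)
    show "\<forall>\<^sub>F e in at_right 0. unit_ball_vol CARD('n) * e ^ CARD('n) = measure lebesgue (ball x e)"
      by (rule eventually_at_rightI[of 0 1]) (auto simp: content_ball)
  qed
  have "((\<lambda>e. - (C * (c / R powr p) * (measure lebesgue S - measure lebesgue (ball x e))))
      \<longlongrightarrow> - (C * (c / R powr p) * (measure lebesgue S - 0))) (at_right 0)"
    by (intro tendsto_intros ball)
  from tendsto_le[OF _ this lim] bound
  have "L \<le> - (C * (c / R powr p) * (measure lebesgue S - 0))"
    by (force intro: eventually_at_rightI[of 0 1])
  then show ?thesis by (simp add: p_def)
qed

section \<open>Translations and the exterior condition\<close>

text \<open>
  The exterior condition speaks of three points on a line. As \<open>G\<close> is bounded, points of the
  complement are available on the line below \<open>x\<close> and above its shift, to serve as the missing ones.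
\<close>
lemma exterior_condition_shift:
  fixes G :: "(real ^ 'n::finite) set"
  assumes "bounded G" and ext: "exterior_condition k G u u" and "\<tau> > 0"
    and out: "x \<notin> G \<or> x + \<tau> *\<^sub>R axis k 1 \<notin> G"
  shows "u x \<le> u (x + \<tau> *\<^sub>R axis k 1)"
    and "x \<in> G \<or> x + \<tau> *\<^sub>R axis k 1 \<in> G \<Longrightarrow> u x < u (x + \<tau> *\<^sub>R axis k 1)"
proof -
  let ?y = "x + \<tau> *\<^sub>R axis k 1"
  obtain B where B: "\<And>z. z \<in> G \<Longrightarrow> norm z \<le> B"
    using \<open>bounded G\<close> by (auto simp: bounded_iff)
  have comp: "(x + t *\<^sub>R axis k 1) $ k = x $ k + t" for t
    by (simp add: axis_def)
  have far: "x + t *\<^sub>R axis k 1 \<notin> G" if "\<bar>x $ k + t\<bar> > B" for t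
    using B component_le_norm_cart[of "x + t *\<^sub>R axis k 1" k] that unfolding comp by fastforce
  define a where "a = x + (- \<bar>B\<bar> - \<bar>x $ k\<bar> - 1) *\<^sub>R axis k 1"
  define b where "b = x + (\<bar>B\<bar> + \<bar>x $ k\<bar> + \<tau> + 1) *\<^sub>R axis k 1"
  have ab: "a \<notin> G" "b \<notin> G"
    unfolding a_def b_def using \<open>\<tau> > 0\<close> by (auto intro!: far)
  have sp: "same_prime k a x" "same_prime k x ?y" "same_prime k ?y b" "same_prime k x b" "same_prime k a ?y"
    by (auto simp: same_prime_def a_def b_def axis_def)
  have lt: "a $ k < x $ k" "x $ k < ?y $ k" "?y $ k < b $ k"
    using \<open>\<tau> > 0\<close> unfolding a_def b_def comp by auto
  have 1: "u x < u ?y" if "x \<in> G" "?y \<notin> G"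
    using ext sp lt ab that unfolding exterior_condition_def by (meson ComplI)
  have 2: "u x < u ?y" if "x \<notin> G" "?y \<in> G"
    using ext sp lt ab that unfolding exterior_condition_def by (meson ComplI)
  have 3: "u x \<le> u ?y" if "x \<notin> G" "?y \<notin> G"
    using ext sp lt ab that unfolding exterior_condition_def by (meson ComplI)
  show "u x \<le> u ?y" "x \<in> G \<or> ?y \<in> G \<Longrightarrow> u x < u ?y"
    using 1 2 3 out by (auto intro: less_imp_le)
qed

text \<open>
  Near a point of \<open>G\<close> that is within \<open>\<tau> / 2\<close> of maximal height, the shift passes above \<open>G\<close>.
\<close>
lemma bounded_open_leaves_itself:
  fixes G :: "(real ^ 'n::finite) set"
  assumes "open G" "G \<noteq> {}" "bounded G" "\<tau> > 0"
  obtains p r where "0 < r" "ball p r \<subseteq> G" "\<And>y. y \<in> ball p r \<Longrightarrow> y + \<tau> *\<^sub>R axis k 1 \<notin> G"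
proof -
  let ?h = "\<lambda>x::real^'n. x $ k"
  have bdd: "bdd_above (?h ` G)"
    using \<open>bounded G\<close> component_le_norm_cart[of _ k] unfolding bounded_iff
    by (meson bdd_aboveI2 abs_le_D1 order_trans)
  have "Sup (?h ` G) - \<tau> / 2 < Sup (?h ` G)" using \<open>\<tau> > 0\<close> by simp
  then obtain p where p: "p \<in> G" "Sup (?h ` G) - \<tau> / 2 < p $ k"
    using less_cSup_iff[OF _ bdd] \<open>G \<noteq> {}\<close> by auto
  obtain r where r: "r > 0" "ball p r \<subseteq> G"
    using p \<open>open G\<close> open_contains_ball by blast
  show thesis
  proof (rule that[of "min r (\<tau> / 2)" p])
    fix y assume y: "y \<in> ball p (min r (\<tau> / 2))"
    then have "norm (p - y) < \<tau> / 2"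
      by (simp add: dist_norm)
    then have "p $ k - y $ k < \<tau> / 2"
      using component_le_norm_cart[of "p - y" k] by simp
    moreover have "(y + \<tau> *\<^sub>R axis k 1) $ k = y $ k + \<tau>"
      by (simp add: axis_def)
    ultimately have "(y + \<tau> *\<^sub>R axis k 1) $ k > Sup (?h ` G)"
      using p by linarith
    then show "y + \<tau> *\<^sub>R axis k 1 \<notin> G"
      using cSup_upper[OF _ bdd] by (metis imageI not_le)
  qed (use r \<open>\<tau> > 0\<close> in auto)
qed

section \<open>Nonlinearities with one-sided derivative bounds\<close>

lemma has_partials_on_swap:
  "has_partials_on (A \<times> B) h h1 h2 \<Longrightarrow> has_partials_on (B \<times> A) (\<lambda>b a. h a b) (\<lambda>b a. h2 a b) (\<lambda>b a. h1 a b)"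
  by (auto simp: has_partials_on_def)

lemma derivative_le_imp_increment_le:
  fixes h :: "real \<Rightarrow> real"
  assumes "a \<le> b" and der: "\<And>t. a \<le> t \<Longrightarrow> t \<le> b \<Longrightarrow> (h has_real_derivative h' t) (at t)"
    and le: "\<And>t. a \<le> t \<Longrightarrow> t \<le> b \<Longrightarrow> h' t \<le> M"
  shows "h b - h a \<le> M * (b - a)"
proof -
  have "M * a - h a \<le> M * b - h b"
  proof (rule DERIV_nonneg_imp_nondecreasing[OF \<open>a \<le> b\<close>])
    fix t assume t: "a \<le> t" "t \<le> b"
    have "((\<lambda>t. M * t - h t) has_real_derivative M * 1 - h' t) (at t)"
      by (intro DERIV_diff DERIV_cmult DERIV_ident der t)
    then show "\<exists>y. ((\<lambda>t. M * t - h t) has_real_derivative y) (at t) \<and> 0 \<le> y"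
      using le[OF t] by auto
  qed
  then show ?thesis by (simp add: algebra_simps)
qed

text \<open>
  Passing from \<open>(a, b)\<close> to \<open>(a - m, b')\<close> through \<open>(a, b')\<close>, the first variable falls by \<open>m\<close>, which
  costs at most \<open>M * m\<close>. The second may rise, which does not lower \<open>h\<close> because \<open>h2\<close> is nonnegative,
  or fall by at most \<open>m\<close>, which again costs at most \<open>M * m\<close>.
\<close>
lemma cooperative_increment_bound:
  fixes I J :: "real set"
  assumes par: "has_partials_on (I \<times> J) h h1 h2" and conn: "connected I" "connected J"
    and h1: "\<And>a b. a \<in> I \<Longrightarrow> b \<in> J \<Longrightarrow> h1 a b \<le> M"
    and h2: "\<And>a b. a \<in> I \<Longrightarrow> b \<in> J \<Longrightarrow> 0 \<le> h2 a b" "\<And>a b. a \<in> I \<Longrightarrow> b \<in> J \<Longrightarrow> h2 a b \<le> M"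
    and "0 \<le> M" "0 \<le> m"
    and mem: "a \<in> I" "a - m \<in> I" "b \<in> J" "b' \<in> J" and b': "b - m \<le> b'"
  shows "h a b - 2 * M * m \<le> h (a - m) b'"
proof -
  have I: "t \<in> I" if "a - m \<le> t" "t \<le> a" for t
    using connectedD_interval[OF conn(1) mem(2,1) that] .
  have J: "t \<in> J" if "min b b' \<le> t" "t \<le> max b b'" for t
    using conn(2) mem(3,4) that by (metis connectedD_interval max_def min_def)
  have 1: "h a b' - h (a - m) b' \<le> M * (a - (a - m))"
    using par I mem \<open>0 \<le> m\<close> unfolding has_partials_on_def
    by (intro derivative_le_imp_increment_le[where h' = "\<lambda>t. h1 t b'"] h1) auto
  have 2: "h a b - h a b' \<le> M * m"
  proof (cases "b \<le> b'")
    case True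
    have "h a b \<le> h a b'"
      using True
    proof (rule DERIV_nonneg_imp_nondecreasing)
      fix t assume "b \<le> t" "t \<le> b'"
      then have "t \<in> J" using J by auto
      then show "\<exists>y. ((\<lambda>t. h a t) has_real_derivative y) (at t) \<and> 0 \<le> y"
        using par mem h2 unfolding has_partials_on_def by blast
    qed
    then show ?thesis using \<open>0 \<le> M\<close> \<open>0 \<le> m\<close> by (smt (verit) mult_nonneg_nonneg)
  next
    case False
    then have "h a b - h a b' \<le> M * (b - b')"
      using par J mem unfolding has_partials_on_def
      by (intro derivative_le_imp_increment_le[where h' = "\<lambda>t. h2 a t"] h2) auto
    also have "\<dots> \<le> M * m"
      using b' \<open>0 \<le> M\<close> by (intro mult_left_mono) auto
    finally show ?thesis .
  qed
  show ?thesis using 1 2 by simp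
qed

section \<open>Sliding for a cooperative system\<close>

text \<open>
  The roles of \<open>u\<close> and \<open>v\<close> are symmetric: exchanging them turns one such system into another
  (lemma \<open>swap\<close> below). So every step that singles out one of the two functions is proved for \<open>u\<close> only
  and then transferred to \<open>v\<close>. One constant \<open>M\<close> bounds all four partial derivatives from above, and
  the exterior data are the values of \<open>u\<close> and \<open>v\<close> themselves outside \<open>G\<close>.
\<close>
locale cooperative_system =
  fixes k :: "'n::finite" and G :: "(real ^ 'n) set" and s C M :: real
    and u v :: "real ^ 'n \<Rightarrow> real" and f g fu fv gu gv :: "real \<Rightarrow> real \<Rightarrow> real"
  assumes s: "0 < s" and C: "0 < C" and M: "0 \<le> M"
    and G: "is_domain G" "bounded G"
    and meas: "u \<in> borel_measurable lebesgue" "v \<in> borel_measurable lebesgue"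
    and cont: "continuous_on (closure G) u" "continuous_on (closure G) v"
    and eq_u: "\<And>x. x \<in> G \<Longrightarrow> has_frac_laplacian C s u x (f (u x) (v x))"
    and eq_v: "\<And>x. x \<in> G \<Longrightarrow> has_frac_laplacian C s v x (g (u x) (v x))"
    and ext: "exterior_condition k G u u" "exterior_condition k G v v"
    and par_f: "has_partials_on (u ` G \<times> v ` G) f fu fv"
    and par_g: "has_partials_on (u ` G \<times> v ` G) g gu gv"
    and f_bounds: "\<And>a b. a \<in> u ` G \<Longrightarrow> b \<in> v ` G \<Longrightarrow> fu a b \<le> M \<and> 0 \<le> fv a b \<and> fv a b \<le> M"
    and g_bounds: "\<And>a b. a \<in> u ` G \<Longrightarrow> b \<in> v ` G \<Longrightarrow> gv a b \<le> M \<and> 0 \<le> gu a b \<and> gu a b \<le> M"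
begin

lemma swap:
  "cooperative_system k G s C M v u (\<lambda>b a. g a b) (\<lambda>b a. f a b)
     (\<lambda>b a. gv a b) (\<lambda>b a. gu a b) (\<lambda>b a. fv a b) (\<lambda>b a. fu a b)"
  using s C M G meas cont eq_u eq_v ext has_partials_on_swap[OF par_f] has_partials_on_swap[OF par_g]
    f_bounds g_bounds
  by unfold_locales auto

definition shift :: "real \<Rightarrow> real ^ 'n \<Rightarrow> real ^ 'n" where
  "shift \<tau> x = x + \<tau> *\<^sub>R axis k 1"

definition ordered :: "real \<Rightarrow> bool" where
  "ordered \<tau> \<longleftrightarrow> (\<forall>x. x \<in> G \<longrightarrow> shift \<tau> x \<in> G \<longrightarrow> u x \<le> u (shift \<tau> x) \<and> v x \<le> v (shift \<tau> x))"

lemma continuous_on_G: "continuous_on G u" "continuous_on G v"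
  using cont continuous_on_subset closure_subset by blast+

lemma open_G: "open G"
  using G by (simp add: is_domain_def)

lemma shift_le_outside:
  assumes "\<tau> > 0" "x \<notin> G \<or> shift \<tau> x \<notin> G"
  shows "u x \<le> u (shift \<tau> x)" "v x \<le> v (shift \<tau> x)"
  using exterior_condition_shift(1)[OF G(2)] ext assms unfolding shift_def by auto

lemma ordered_everywhere:
  assumes "\<tau> > 0" "ordered \<tau>"
  shows "u x \<le> u (shift \<tau> x)" "v x \<le> v (shift \<tau> x)"
  using assms shift_le_outside unfolding ordered_def by blast+

text \<open>
  Both maximum principles come from this inequality, in which \<open>- m\<close> is the least increment of \<open>u\<close>
  under the shift. The equations hold at \<open>x\<close> and at \<open>shift \<tau> x\<close>, so the increment of \<open>u\<close> has a
  fractional Laplacian at \<open>x\<close>, namely the increment of \<open>f\<close>. Cooperativity bounds it from below by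
  \<open>- 2 * M * m\<close>, while minimality at \<open>x\<close> makes it negative by an amount proportional to the
  measure of any set on which the increment exceeds its minimum by \<open>c\<close>. The case \<open>m = 0\<close> gives the
  strong maximum principle, the case \<open>c = m\<close> the narrow region principle.
\<close>
lemma increment_at_minimum:
  assumes "\<tau> > 0" and x: "x \<in> G" "shift \<tau> x \<in> G" and m: "m \<ge> 0" "u (shift \<tau> x) = u x - m"
    and u_min: "\<And>y. u y - m \<le> u (shift \<tau> y)" and v_min: "v x - m \<le> v (shift \<tau> x)"
    and S: "S \<in> sets lebesgue" "S \<subseteq> cball x R"
    and c: "0 \<le> c" "\<And>y. y \<in> S \<Longrightarrow> u y - m + c \<le> u (shift \<tau> y)"
  shows "C * c * measure lebesgue S / R powr (real CARD('n) + 2 * s) \<le> 2 * M * m"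
proof -
  define w where "w y = u (shift \<tau> y) - u y" for y
  define L where "L = f (u (shift \<tau> x)) (v (shift \<tau> x)) - f (u x) (v x)"
  have "has_frac_laplacian C s w x L"
    unfolding w_def L_def shift_def using x
    by (intro has_frac_laplacian_diff has_frac_laplacian_shift meas eq_u) (auto simp: shift_def)
  then have "C * c * measure lebesgue S / R powr (real CARD('n) + 2 * s) \<le> - L"
  proof (rule has_frac_laplacian_at_minimum[OF s C])
    show "w x \<le> w y" for y
      using u_min[of y] m by (simp add: w_def)
    show "w x + c \<le> w y" if "y \<in> S" for y
      using c(2)[OF that] m by (simp add: w_def)
  qed (use S c in auto)
  moreover have "f (u x) (v x) - 2 * M * m \<le> f (u x - m) (v (shift \<tau> x))"
    using par_f
  proof (rule cooperative_increment_bound)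
    show "connected (u ` G)" "connected (v ` G)"
      using G continuous_on_G by (auto simp: is_domain_def intro: connected_continuous_image)
    show "u x - m \<in> u ` G"
      using x m by (metis image_eqI)
  qed (use f_bounds x m M v_min in auto)
  ultimately show ?thesis
    unfolding L_def m(2) by linarith
qed

text \<open>
  Strong maximum principle. If the nonnegative increment of \<open>u\<close> vanished at \<open>x\<close>, the previous
  inequality with \<open>m = 0\<close> would make it vanish almost everywhere. But the shift moves some ball inside
  \<open>G\<close> out of \<open>G\<close>, and the strict part of the exterior condition makes the increment positive there.
\<close>
lemma ordered_imp_strict:
  assumes "\<tau> > 0" and ord: "ordered \<tau>" and x: "x \<in> G" "shift \<tau> x \<in> G"
  shows "u x < u (shift \<tau> x)"
proof (rule ccontr)
  assume "\<not> u x < u (shift \<tau> x)"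
  then have eq: "u (shift \<tau> x) = u x"
    using ordered_everywhere(1)[OF assms(1,2), of x] by simp
  obtain p r where r: "r > 0" "ball p r \<subseteq> G" "\<And>y. y \<in> ball p r \<Longrightarrow> shift \<tau> y \<notin> G"
    using bounded_open_leaves_itself[OF open_G _ G(2) \<open>\<tau> > 0\<close>] G(1)
    unfolding is_domain_def shift_def by metis
  have strict: "u y < u (shift \<tau> y)" if "y \<in> ball p r" for y
    using exterior_condition_shift(2)[OF G(2) ext(1) \<open>\<tau> > 0\<close>] r that unfolding shift_def by blast
  \<comment> \<open>On the ball the increment is positive without a uniform lower bound, as \<open>u\<close> need not be
    continuous outside \<open>G\<close>; the sets \<open>S i\<close> on which it is at least \<open>1 / (i + 1)\<close> exhaust the ball.\<close>
  define S where "S i = {y \<in> ball p r. inverse (real (Suc i)) \<le> u (shift \<tau> y) - u y}" for i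
  define R where "R = dist x p + r"
  have "R > 0" using \<open>r > 0\<close> by (simp add: R_def add_nonneg_pos)
  have mS: "S i \<in> sets lebesgue" for i
  proof -
    have [measurable]: "(\<lambda>y. u (shift \<tau> y) - u y) \<in> borel_measurable lebesgue"
      unfolding shift_def by (intro borel_measurable_diff measurable_shift meas)
    have "{y \<in> space lebesgue. inverse (real (Suc i)) \<le> u (shift \<tau> y) - u y} \<in> sets lebesgue"
      by measurable
    moreover have "S i = ball p r \<inter> {y \<in> space lebesgue. inverse (real (Suc i)) \<le> u (shift \<tau> y) - u y}"
      by (auto simp: S_def)
    ultimately show ?thesis by auto
  qed
  have SR: "S i \<subseteq> cball x R" for i
  proof
    fix y assume "y \<in> S i"
    then have "dist p y < r" by (simp add: S_def)
    then show "y \<in> cball x R"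
      using dist_triangle[of x y p] by (simp add: R_def)
  qed
  have "measure lebesgue (S i) \<le> 0" for i
  proof -
    have "C * inverse (real (Suc i)) * measure lebesgue (S i) / R powr (real CARD('n) + 2 * s) \<le> 2 * M * 0"
      using ordered_everywhere[OF assms(1,2)] eq
      by (intro increment_at_minimum[OF \<open>\<tau> > 0\<close> x _ _ _ _ mS SR]) (auto simp: S_def)
    then show ?thesis
      using C \<open>R > 0\<close> by (simp add: divide_le_0_iff mult_le_0_iff add_pos_nonneg)
  qed
  moreover have "S i \<in> lmeasurable" for i
    using mS SR by (meson bounded_cball bounded_set_imp_lmeasurable bounded_subset)
  ultimately have "negligible (S i)" for i
    by (simp add: negligible_iff_measure order_antisym)
  then have "S i \<in> null_sets lebesgue" for i
    by (simp add: negligible_iff_null_sets)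
  then have "(\<Union>i. S i) \<in> null_sets lebesgue" by blast
  moreover have "(\<Union>i. S i) = ball p r"
  proof
    show "ball p r \<subseteq> (\<Union>i. S i)"
    proof
      fix y assume y: "y \<in> ball p r"
      then obtain i where "inverse (real (Suc i)) < u (shift \<tau> y) - u y"
        using reals_Archimedean[of "u (shift \<tau> y) - u y"] strict by auto
      with y show "y \<in> (\<Union>i. S i)" unfolding S_def by (auto intro: less_imp_le)
    qed
  qed (auto simp: S_def)
  ultimately have "negligible (ball p r)"
    by (simp add: negligible_iff_null_sets)
  then show False
    using open_not_negligible[of "ball p r"] \<open>r > 0\<close> by simp
qed

text \<open>
  Outside \<open>E\<close> the increment lies above its minimum \<open>- m\<close> by at least \<open>m\<close>. Since \<open>E\<close> fills at most
  half of the ball of radius \<open>R\<close> about \<open>x\<close>, the nonlocal term is at least \<open>m\<close> times a multiple of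
  \<open>R powr (- 2 * s)\<close>, which for small \<open>R\<close> exceeds the reaction term \<open>2 * M * m\<close>; the hypothesis on
  \<open>R\<close> is this comparison divided by \<open>m\<close> and multiplied by \<open>R powr (n + 2 * s)\<close>. Only the measure of \<open>E\<close>
  matters, not its shape.
\<close>
lemma no_negative_minimum_in_narrow_set:
  assumes "\<tau> > 0" and x: "x \<in> G" "shift \<tau> x \<in> G" and m: "m > 0" "u (shift \<tau> x) = u x - m"
    and u_min: "\<And>y. u y - m \<le> u (shift \<tau> y)" and v_min: "v x - m \<le> v (shift \<tau> x)"
    and E: "E \<in> lmeasurable" "\<And>y. y \<notin> E \<Longrightarrow> u y \<le> u (shift \<tau> y)"
    and R: "R > 0" "2 * M * R powr (real CARD('n) + 2 * s) < C * (unit_ball_vol CARD('n) * R ^ CARD('n) / 2)"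
    and narrow: "measure lebesgue E \<le> unit_ball_vol CARD('n) * R ^ CARD('n) / 2"
  shows False
proof -
  have "measure lebesgue (cball x R) \<le> measure lebesgue (cball x R - E \<union> E)"
    using E by (intro measure_mono_fmeasurable) (auto intro: fmeasurable.Diff fmeasurable.Un)
  also have "\<dots> \<le> measure lebesgue (cball x R - E) + measure lebesgue E"
    using E by (intro measure_Un_le) auto
  finally have "unit_ball_vol CARD('n) * R ^ CARD('n) / 2 \<le> measure lebesgue (cball x R - E)"
    using narrow \<open>R > 0\<close> by (simp add: content_cball)
  then have "C * (unit_ball_vol CARD('n) * R ^ CARD('n) / 2) \<le> C * measure lebesgue (cball x R - E)"
    using C by simp
  moreover have "C * m * measure lebesgue (cball x R - E) / R powr (real CARD('n) + 2 * s) \<le> 2 * M * m"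
    using m E by (intro increment_at_minimum[OF \<open>\<tau> > 0\<close> x _ m(2) u_min v_min]) auto
  then have "C * measure lebesgue (cball x R - E) \<le> 2 * M * R powr (real CARD('n) + 2 * s)"
    using m \<open>R > 0\<close> by (simp add: pos_divide_le_eq)
  ultimately show False using R by linarith
qed

text \<open>
  If the ordering is known on a set \<open>K\<close> that nearly exhausts \<open>G\<close>, it holds on all of \<open>G\<close>. The worst
  of the two increments is a continuous function on the compact set of points that the shift keeps in
  the closure of \<open>G\<close>, so it attains its minimum. A negative minimum is attained inside \<open>G\<close>, by the
  exterior condition, and there one of \<open>u\<close>, \<open>v\<close> is in the situation excluded by the previous lemma.
\<close>
lemma narrow_region_principle:
  assumes "\<tau> > 0" and R: "R > 0" "2 * M * R powr (real CARD('n) + 2 * s) < C * (unit_ball_vol CARD('n) * R ^ CARD('n) / 2)"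
    and K: "G - K \<in> lmeasurable" "measure lebesgue (G - K) \<le> unit_ball_vol CARD('n) * R ^ CARD('n) / 4"
    and on_K: "\<And>x. x \<in> K \<Longrightarrow> shift \<tau> x \<in> K \<Longrightarrow> u x \<le> u (shift \<tau> x) \<and> v x \<le> v (shift \<tau> x)"
  shows "ordered \<tau>"
proof -
  interpret sw: cooperative_system k G s C M v u "\<lambda>b a. g a b" "\<lambda>b a. f a b"
     "\<lambda>b a. gv a b" "\<lambda>b a. gu a b" "\<lambda>b a. fv a b" "\<lambda>b a. fu a b" by (rule swap)
  define h where "h = \<tau> *\<^sub>R (axis k 1 :: real ^ 'n)"
  have shift: "shift \<tau> x = x + h" for x by (simp add: shift_def h_def)
  define q where "q x = min (u (shift \<tau> x) - u x) (v (shift \<tau> x) - v x)" for x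
  have q_out: "0 \<le> q x" if "x \<notin> G \<or> shift \<tau> x \<notin> G" for x
    using shift_le_outside[OF \<open>\<tau> > 0\<close> that] by (simp add: q_def)
  \<comment> \<open>A point outside \<open>E\<close> either lies in \<open>K\<close> together with its shift, or one of the two is outside \<open>G\<close>.\<close>
  define E where "E = (G - K) \<union> (\<lambda>x. - h + x) ` (G - K)"
  have E: "E \<in> lmeasurable"
    unfolding E_def using K by (intro fmeasurable.Un measurable_translation)
  have "measure lebesgue E \<le> measure lebesgue (G - K) + measure lebesgue ((\<lambda>x. - h + x) ` (G - K))"
    unfolding E_def using K by (intro measure_Un_le fmeasurableD measurable_translation)
  then have mE: "measure lebesgue E \<le> unit_ball_vol CARD('n) * R ^ CARD('n) / 2"
    unfolding measure_translation using K(2) by linarith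
  have q_E: "0 \<le> q y" if "y \<notin> E" for y
  proof (cases "y \<in> G \<and> shift \<tau> y \<in> G")
    case True
    have "y = - h + shift \<tau> y" by (simp add: shift)
    then have "y \<in> K" "shift \<tau> y \<in> K"
      using True \<open>y \<notin> E\<close> unfolding E_def by blast+
    then show ?thesis using on_K by (simp add: q_def)
  qed (use q_out in blast)
  define A where "A = closure G \<inter> (\<lambda>x. - h + x) ` closure G"
  have A_iff: "x \<in> A \<longleftrightarrow> x \<in> closure G \<and> shift \<tau> x \<in> closure G" for x
    unfolding A_def shift image_iff Int_iff by (metis add.commute add_uminus_conv_diff diff_add_cancel)
  have "compact A"
    unfolding A_def using G by (intro compact_Int compact_translation) (auto simp: compact_closure)
  have "continuous_on A q"
    unfolding q_def shift using A_iff unfolding shift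
    by (intro continuous_intros continuous_on_compose2[OF cont(1)] continuous_on_compose2[OF cont(2)]) auto
  have "0 \<le> q y" for y
  proof (rule ccontr)
    assume neg: "\<not> 0 \<le> q y"
    have in_A: "z \<in> A" if "\<not> 0 \<le> q z" for z
      using q_out that A_iff closure_subset by blast
    obtain x where x: "x \<in> A" "\<And>z. z \<in> A \<Longrightarrow> q x \<le> q z"
      using continuous_attains_inf[OF \<open>compact A\<close> _ \<open>continuous_on A q\<close>] in_A[OF neg] by blast
    define m where "m = - q x"
    have "m > 0" using x(2)[OF in_A[OF neg]] neg by (simp add: m_def)
    then have xG: "x \<in> G" "shift \<tau> x \<in> G" using q_out[of x] by (auto simp: m_def)
    have le: "- m \<le> q z" for z
      using x(2)[of z] in_A[of z] \<open>m > 0\<close> by (cases "0 \<le> q z") (auto simp: m_def)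
    have u_min: "u z - m \<le> u (shift \<tau> z)" and v_min: "v z - m \<le> v (shift \<tau> z)" for z
      using le[of z] by (auto simp: q_def)
    have E_le: "u z \<le> u (shift \<tau> z)" "v z \<le> v (shift \<tau> z)" if "z \<notin> E" for z
      using q_E[OF that] by (auto simp: q_def)
    have "u (shift \<tau> x) = u x - m \<or> v (shift \<tau> x) = v x - m"
      by (cases "u (shift \<tau> x) - u x \<le> v (shift \<tau> x) - v x") (simp_all add: m_def q_def min_def)
    then show False
    proof (elim disjE)
      assume 1: "u (shift \<tau> x) = u x - m"
      show False
        using no_negative_minimum_in_narrow_set[OF \<open>\<tau> > 0\<close> xG \<open>m > 0\<close> 1 u_min v_min E E_le(1) R mE] .
    next
      assume 2: "v (shift \<tau> x) = v x - m"
      show False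
        using sw.no_negative_minimum_in_narrow_set[OF \<open>\<tau> > 0\<close> xG \<open>m > 0\<close> 2 v_min u_min E E_le(2) R mE] .
    qed
  qed
  then show ?thesis by (auto simp: ordered_def q_def)
qed

text \<open>
  Both sides scale in \<open>R\<close>; their quotient is a multiple of \<open>R powr (2 * s)\<close>, which tends to \<open>0\<close>.
\<close>
lemma narrow_radius_exists:
  obtains R where "R > 0"
    "2 * M * R powr (real CARD('n) + 2 * s) < C * (unit_ball_vol CARD('n) * R ^ CARD('n) / 2)"
proof -
  define V where "V = unit_ball_vol CARD('n)"
  have "V > 0" by (simp add: V_def)
  have "((\<lambda>R. 2 * M * R powr (2 * s)) \<longlongrightarrow> 2 * M * 0) (at_right 0)"
    using s by (intro tendsto_mult tendsto_const tendsto_zero_powrI[where b = "2 * s"] tendsto_ident_at)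
      (auto intro: eventually_at_rightI[of 0 1])
  then have "\<forall>\<^sub>F R in at_right 0. 2 * M * R powr (2 * s) < C * (V / 2)"
    using C \<open>V > 0\<close> by (intro order_tendstoD) auto
  moreover have "\<forall>\<^sub>F R in at_right (0::real). R > 0"
    by (simp add: eventually_at_right_less)
  ultimately have "\<forall>\<^sub>F R in at_right 0. R > 0 \<and> 2 * M * R powr (2 * s) < C * (V / 2)"
    by eventually_elim simp
  then obtain R where R: "R > 0" "2 * M * R powr (2 * s) < C * (V / 2)"
    using eventually_happens'[OF trivial_limit_at_right_real] by blast
  then have "(2 * M * R powr (2 * s)) * R ^ CARD('n) < (C * (V / 2)) * R ^ CARD('n)"
    by (intro mult_strict_right_mono zero_less_power)
  then show thesis
    using R by (intro that[of R]) (auto simp: V_def powr_add powr_realpow mult_ac)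
qed

lemma not_ordered_open: "open {\<tau>. \<not> ordered \<tau>}"
proof -
  have "open {\<tau>. shift \<tau> x \<in> G \<and> (u (shift \<tau> x) < u x \<or> v (shift \<tau> x) < v x)}" for x
  proof -
    let ?W = "(G \<inter> u -` {..<u x}) \<union> (G \<inter> v -` {..<v x})"
    have "open ?W"
      using continuous_on_G open_G by (intro open_Un continuous_open_preimage open_lessThan)
    moreover have "continuous_on UNIV (\<lambda>\<tau>. shift \<tau> x)"
      unfolding shift_def by (intro continuous_intros)
    ultimately have "open ((\<lambda>\<tau>. shift \<tau> x) -` ?W)"
      using continuous_open_vimage by (metis continuous_on_eq_continuous_at open_UNIV iso_tuple_UNIV_I)
    moreover have "(\<lambda>\<tau>. shift \<tau> x) -` ?W
        = {\<tau>. shift \<tau> x \<in> G \<and> (u (shift \<tau> x) < u x \<or> v (shift \<tau> x) < v x)}"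
      by auto
    ultimately show ?thesis by simp
  qed
  then have "open (\<Union>x\<in>G. {\<tau>. shift \<tau> x \<in> G \<and> (u (shift \<tau> x) < u x \<or> v (shift \<tau> x) < v x)})"
    by blast
  moreover have "(\<Union>x\<in>G. {\<tau>. shift \<tau> x \<in> G \<and> (u (shift \<tau> x) < u x \<or> v (shift \<tau> x) < v x)})
      = {\<tau>. \<not> ordered \<tau>}"
    by (auto simp: ordered_def not_le)
  ultimately show ?thesis by simp
qed

text \<open>
  This is the step that lets the sliding continue. Take a compact \<open>K \<subseteq> G\<close> so large that the narrow
  region principle applies to \<open>G - K\<close>. If shifts \<open>\<sigma>\<close> arbitrarily close to \<open>\<tau>\<close> failed to be ordered,
  they would fail at points \<open>x\<close> with both \<open>x\<close> and \<open>shift \<sigma> x\<close> in \<open>K\<close>; a limit of these points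
  would contradict the strict inequality for \<open>\<tau>\<close>.
\<close>
lemma ordered_persists_nearby:
  assumes "\<tau> > 0" "ordered \<tau>"
  shows "\<exists>e>0. \<forall>\<sigma>. dist \<sigma> \<tau> < e \<longrightarrow> \<sigma> > 0 \<longrightarrow> ordered \<sigma>"
proof (rule ccontr)
  assume contr: "\<not> ?thesis"
  interpret sw: cooperative_system k G s C M v u "\<lambda>b a. g a b" "\<lambda>b a. f a b"
     "\<lambda>b a. gv a b" "\<lambda>b a. gu a b" "\<lambda>b a. fv a b" "\<lambda>b a. fu a b" by (rule swap)
  have sw_ord: "sw.ordered \<tau>"
    using assms(2) unfolding sw.ordered_def ordered_def by blast
  obtain R where R: "R > 0"
    "2 * M * R powr (real CARD('n) + 2 * s) < C * (unit_ball_vol CARD('n) * R ^ CARD('n) / 2)"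
    by (rule narrow_radius_exists)
  define d where "d = unit_ball_vol CARD('n) * R ^ CARD('n) / 4"
  have "d > 0" using R by (simp add: d_def)
  obtain K where K: "closed K" "K \<subseteq> G" "G - K \<in> lmeasurable" "emeasure lebesgue (G - K) < ennreal d"
    using sets_lebesgue_inner_closed[of G d] open_G \<open>d > 0\<close> by auto
  have "compact K"
    using K G(2) by (meson bounded_subset compact_eq_bounded_closed)
  have mK: "measure lebesgue (G - K) \<le> d"
    using K(4) \<open>d > 0\<close> by (simp add: emeasure_eq_measure2[OF K(3)] ennreal_less_iff)
  define q where "q \<sigma> x = min (u (shift \<sigma> x) - u x) (v (shift \<sigma> x) - v x)" for \<sigma> x
  have "\<exists>\<sigma> x. dist \<sigma> \<tau> < inverse (real (Suc i)) \<and> x \<in> K \<and> shift \<sigma> x \<in> K \<and> q \<sigma> x \<le> 0" for i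
  proof -
    have "inverse (real (Suc i)) > 0" by simp
    then obtain \<sigma> where \<sigma>: "dist \<sigma> \<tau> < inverse (real (Suc i))" "\<sigma> > 0" "\<not> ordered \<sigma>"
      using contr by blast
    obtain x where x: "x \<in> K" "shift \<sigma> x \<in> K" "\<not> (u x \<le> u (shift \<sigma> x) \<and> v x \<le> v (shift \<sigma> x))"
      using narrow_region_principle[OF \<sigma>(2) R K(3) mK[unfolded d_def]] \<sigma>(3) by blast
    have "q \<sigma> x \<le> 0"
      unfolding q_def using x(3) by linarith
    with x \<sigma> show ?thesis by blast
  qed
  then obtain \<sigma> x where \<sigma>: "\<And>i. dist (\<sigma> i) \<tau> < inverse (real (Suc i))"
    and x: "\<And>i. x i \<in> K" "\<And>i. shift (\<sigma> i) (x i) \<in> K" "\<And>i. q (\<sigma> i) (x i) \<le> 0"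
    by metis
  obtain a r where a: "a \<in> K" "strict_mono (r :: nat \<Rightarrow> nat)" "(x \<circ> r) \<longlonglongrightarrow> a"
    using seq_compactE[OF compact_imp_seq_compact[OF \<open>compact K\<close>], of x] x(1) by blast
  have "(\<lambda>i. dist (\<sigma> i) \<tau>) \<longlonglongrightarrow> 0"
    by (rule tendsto_sandwich[OF _ _ tendsto_const LIMSEQ_inverse_real_of_nat])
      (use \<sigma> in \<open>auto intro!: always_eventually less_imp_le\<close>)
  then have "(\<lambda>i. \<sigma> (r i)) \<longlonglongrightarrow> \<tau>"
    using LIMSEQ_subseq_LIMSEQ[OF _ a(2), of \<sigma>] by (simp add: tendsto_dist_iff[of \<sigma>] comp_def)
  then have lim: "(\<lambda>i. shift (\<sigma> (r i)) (x (r i))) \<longlonglongrightarrow> shift \<tau> a"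
    using a(3) unfolding shift_def comp_def by (intro tendsto_intros)
  have "shift \<tau> a \<in> K"
    using closed_sequentially[OF K(1) _ lim] x(2) by blast
  then have aG: "a \<in> G" "shift \<tau> a \<in> G" using a K by auto
  have at: "isCont u a" "isCont v a" "isCont u (shift \<tau> a)" "isCont v (shift \<tau> a)"
    using continuous_on_G aG open_G by (auto simp: continuous_on_eq_continuous_at)
  have "(\<lambda>i. q (\<sigma> (r i)) (x (r i))) \<longlonglongrightarrow> q \<tau> a"
    unfolding q_def using a(3) lim unfolding comp_def
    by (intro tendsto_min tendsto_diff isCont_tendsto_compose[OF at(1)] isCont_tendsto_compose[OF at(2)]
         isCont_tendsto_compose[OF at(3)] isCont_tendsto_compose[OF at(4)])
  then have "q \<tau> a \<le> 0"
    using x(3) by (intro LIMSEQ_le_const2) auto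
  moreover have "0 < q \<tau> a"
    using ordered_imp_strict[OF assms aG] sw.ordered_imp_strict[OF assms(1) sw_ord, of a] aG
    by (simp add: q_def)
  ultimately show False by simp
qed

text \<open>
  Once the shift exceeds the diameter of \<open>G\<close>, no point and its shift are both in \<open>G\<close>.
\<close>
lemma ordered_large: "\<exists>\<tau>>0. ordered \<tau>"
proof -
  obtain B where B: "\<And>z. z \<in> G \<Longrightarrow> norm z \<le> B" "B > 0"
    using G(2) bounded_pos by blast
  have "False" if "x \<in> G" "shift (3 * B) x \<in> G" for x
  proof -
    have "norm (shift (3 * B) x - x) = 3 * B"
      using B(2) by (simp add: shift_def norm_axis_1)
    then show ?thesis
      using B(1)[OF that(1)] B(1)[OF that(2)] B(2) norm_triangle_ineq4[of "shift (3 * B) x" x]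
      by linarith
  qed
  then have "ordered (3 * B)"
    unfolding ordered_def by blast
  with B(2) show ?thesis
    by (intro exI[of _ "3 * B"]) simp
qed

lemma ordered_all:
  assumes "\<tau> > 0"
  shows "ordered \<tau>"
proof (rule ccontr)
  assume "\<not> ordered \<tau>"
  let ?T = "{\<tau>. \<tau> > 0 \<and> ordered \<tau>}"
  have "open ?T"
    unfolding open_dist
  proof
    fix \<sigma> assume \<sigma>: "\<sigma> \<in> ?T"
    then obtain e where e: "e > 0" "\<And>\<rho>. dist \<rho> \<sigma> < e \<Longrightarrow> \<rho> > 0 \<Longrightarrow> ordered \<rho>"
      using ordered_persists_nearby[of \<sigma>] by auto
    then show "\<exists>e>0. \<forall>y. dist y \<sigma> < e \<longrightarrow> y \<in> ?T"
      using \<sigma> by (intro exI[of _ "min e \<sigma>"]) (auto simp: dist_real_def)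
  qed
  then have "?T \<inter> {0<..} = {} \<or> {\<tau>. \<not> ordered \<tau>} \<inter> {0<..} = {}"
    by (rule connectedD[OF connected_Ioi _ not_ordered_open]) auto
  then show False
    using ordered_large \<open>\<not> ordered \<tau>\<close> assms by auto
qed

lemma strictly_increasing:
  assumes "\<tau> > 0" "x \<in> G" "x + \<tau> *\<^sub>R axis k 1 \<in> G"
  shows "u x < u (x + \<tau> *\<^sub>R axis k 1)"
  using ordered_imp_strict[OF assms(1) ordered_all[OF assms(1)], of x] assms by (simp add: shift_def)

end

section \<open>Monotonicity of the solutions\<close>

lemma bdd_above_two_variables:
  assumes "bdd_above ((\<lambda>(a, b). h a b) ` (I \<times> J))"
  obtains M :: real where "\<And>a b. a \<in> I \<Longrightarrow> b \<in> J \<Longrightarrow> h a b \<le> M"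
  using assms unfolding bdd_above_def by fastforce

theorem theorem1p1:
  fixes k :: "'n::finite"
    and G :: "(real ^ 'n) set"
    and s C :: real
    and u v \<phi> \<psi> :: "real ^ 'n \<Rightarrow> real"
    and f g fu fv gu gv :: "real \<Rightarrow> real \<Rightarrow> real"
  assumes "0 < s" and "s < 1" and "0 < C"
    and "is_domain G" and "bounded G" and "convex_in_direction k G"
    and "u \<in> L2s s \<inter> C11_loc G" and "continuous_on (closure G) u"
    and "v \<in> L2s s \<inter> C11_loc G" and "continuous_on (closure G) v"
    and "\<And>x. x \<in> G \<Longrightarrow> has_frac_laplacian C s u x (f (u x) (v x))"
    and "\<And>x. x \<in> G \<Longrightarrow> has_frac_laplacian C s v x (g (u x) (v x))"
    and "\<And>x. x \<in> - G \<Longrightarrow> u x = \<phi> x"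
    and "\<And>x. x \<in> - G \<Longrightarrow> v x = \<psi> x"
    and "exterior_condition k G \<phi> u" and "exterior_condition k G \<psi> v"
    and "has_partials_on (u ` G \<times> v ` G) f fu fv"
    and "has_partials_on (u ` G \<times> v ` G) g gu gv"
    and "\<And>a b. a \<in> u ` G \<Longrightarrow> b \<in> v ` G \<Longrightarrow> 0 < fv a b"
    and "\<And>a b. a \<in> u ` G \<Longrightarrow> b \<in> v ` G \<Longrightarrow> 0 < gu a b"
    and "bdd_above ((\<lambda>(a, b). fu a b) ` (u ` G \<times> v ` G))"
    and "bdd_above ((\<lambda>(a, b). fv a b) ` (u ` G \<times> v ` G))"
    and "bdd_above ((\<lambda>(a, b). gu a b) ` (u ` G \<times> v ` G))"
    and "bdd_above ((\<lambda>(a, b). gv a b) ` (u ` G \<times> v ` G))"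
  shows "\<forall>\<tau>>0. \<forall>x. x \<in> G \<and> x + \<tau> *\<^sub>R axis k 1 \<in> G \<longrightarrow>
           u x < u (x + \<tau> *\<^sub>R axis k 1) \<and> v x < v (x + \<tau> *\<^sub>R axis k 1)"
proof -
  obtain M1 where M1: "\<And>a b. a \<in> u ` G \<Longrightarrow> b \<in> v ` G \<Longrightarrow> fu a b \<le> M1"
    using bdd_above_two_variables assms(21) by metis
  obtain M2 where M2: "\<And>a b. a \<in> u ` G \<Longrightarrow> b \<in> v ` G \<Longrightarrow> fv a b \<le> M2"
    using bdd_above_two_variables assms(22) by metis
  obtain M3 where M3: "\<And>a b. a \<in> u ` G \<Longrightarrow> b \<in> v ` G \<Longrightarrow> gu a b \<le> M3"
    using bdd_above_two_variables assms(23) by metis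
  obtain M4 where M4: "\<And>a b. a \<in> u ` G \<Longrightarrow> b \<in> v ` G \<Longrightarrow> gv a b \<le> M4"
    using bdd_above_two_variables assms(24) by metis
  define M where "M = \<bar>M1\<bar> + \<bar>M2\<bar> + \<bar>M3\<bar> + \<bar>M4\<bar>"
  have ext: "exterior_condition k G u u" "exterior_condition k G v v"
    using assms(13-16) unfolding exterior_condition_def by auto
  interpret cooperative_system k G s C M u v f g fu fv gu gv
  proof
    show "u \<in> borel_measurable lebesgue" "v \<in> borel_measurable lebesgue"
      using assms(7,9) by (auto simp: L2s_def)
    show "0 \<le> M" by (simp add: M_def)
    fix a b assume "a \<in> u ` G" "b \<in> v ` G"
    from M1[OF this] M2[OF this] M3[OF this] M4[OF this] assms(19)[OF this] assms(20)[OF this]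
    show "fu a b \<le> M \<and> 0 \<le> fv a b \<and> fv a b \<le> M" "gv a b \<le> M \<and> 0 \<le> gu a b \<and> gu a b \<le> M"
      unfolding M_def by linarith+
  qed (use assms ext in auto)
  interpret sw: cooperative_system k G s C M v u "\<lambda>b a. g a b" "\<lambda>b a. f a b"
     "\<lambda>b a. gv a b" "\<lambda>b a. gu a b" "\<lambda>b a. fv a b" "\<lambda>b a. fu a b" by (rule swap)
  show ?thesis
    using strictly_increasing sw.strictly_increasing by blast
qed

end
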